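(* Let $n\in N$. For every ultrafilter $x\in\beta N$: $x\in\overline{L_n}$ if and only if there is $\alpha\in\mathcal{A}$ with $\sigma(\alpha)=n$ and $F_\alpha\subseteq x$.
   Context: $N=\{1,2,3,\dots\}$; $\beta N$ is the set of ultrafilters on $N$, each $n\in N$ being identified with the principal ultrafilter at $n$; $\overline{A}=\{x\in\beta N: A\in x\}$ for $A\subseteq N$. $P$ is the set of prime numbers. For $n\ge 1$, $L_n=\{a_1a_2\cdots a_n: a_1,\dots,a_n\in P\}$ (not necessarily distinct). For $A\subseteq N$, $A^k=\{a^k:a\in A\}$; for an ultrafilter $p$, $p^k=\{B\subseteq N:\{a\in N: a^k\in B\}\in p\}$ (the ultrafilter generated by the sets $A^k$, $A\in p$). For $p\in\overline{P}$, $p\restriction P=\{X\cap P:X\in p\}$. A basic ultrafilter is one of the form $p^k$ with $p\in\overline{P}$, $k\in N$ (it determines $p$ and $k$); $\mathcal{B}$ is the set of all basic ultrafilters. $\mathcal{A}$ is the set of all functions $\alpha:\mathcal{B}\to N\cup\{0\}$ with finite support. One writes $\alpha=\{(p_1^{k_1},n_1),\dots,(p_m^{k_m},n_m)\}$, with $p_i^{k_i}$ pairwise distinct, if $\alpha(p_i^{k_i})=n_i$ for all $i$ and $\alpha(b)=0$ for all other $b\in\mathcal{B}$ (some $n_i$ may be $0$). For such $\alpha$, $F_\alpha$ is the family of all sets $$(A_1^{k_1})^{(n_1)}\cdots(A_m^{k_m})^{(n_m)}=\Big\{\prod_{i=1}^m\prod_{j=1}^{n_i}a_{i,j}^{k_i}: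 a_{i,j}\in A_i\text{ for all }i,j,\text{ and all }a_{i,j}\text{ are distinct}\Big\}$$ such that (i) $A_i\in p_i\restriction P$, and (ii) $A_i=A_j$ if $p_i=p_j$, and $A_i\cap A_j=\emptyset$ otherwise. (Whether $F_\alpha\subseteq x$ holds does not depend on which terms with $n_i=0$ are listed.) $\sigma(\alpha)=\sum_{i=1}^m k_in_i$. *)

theory Defs
  imports "HOL-Computational_Algebra.Primes"
begin

definition Npos :: "nat set" where
  "Npos = {1..}"

definition Primes :: "nat set" where
  "Primes = {p. prime p}"

definition L :: "nat \<Rightarrow> nat set" where
  "L n = {\<Prod>i=1..n. a i | a. \<forall>i\<in>{1..n}. a i \<in> Primes}"

definition ultrafilter :: "'a filter \<Rightarrow> bool" where
  "ultrafilter x \<longleftrightarrow> x \<noteq> bot \<and>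
     (\<forall>Q. eventually Q x \<or> eventually (\<lambda>a. \<not> Q a) x)"

text \<open>An ultrafilter on \<^term>\<open>Npos\<close> is represented by a filter on the type \<^typ>\<open>nat\<close> that
  contains \<^term>\<open>Npos\<close>; its family of sets in the usual sense is its trace on \<^term>\<open>Npos\<close>,
  \<open>sets_of\<close> below.\<close>

definition betaN :: "nat filter set" where
  "betaN = {x. ultrafilter x \<and> eventually (\<lambda>a. a \<in> Npos) x}"

definition sets_of :: "nat filter \<Rightarrow> nat set set" where
  "sets_of x = {A. A \<subseteq> Npos \<and> eventually (\<lambda>a. a \<in> A) x}"

definition closure_beta :: "nat set \<Rightarrow> nat filter set" where
  "closure_beta A = {x \<in> betaN. A \<in> sets_of x}"

definition restrict_Primes :: "nat filter \<Rightarrow> nat set set" where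
  "restrict_Primes p = {X \<inter> Primes | X. X \<in> sets_of p}"

definition upower :: "nat filter \<Rightarrow> nat \<Rightarrow> nat filter" where
  "upower p k = filtermap (\<lambda>a. a ^ k) p"

lemma sets_of_upower:
  assumes "p \<in> betaN"
  shows "sets_of (upower p k) = {B. B \<subseteq> Npos \<and> {a \<in> Npos. a ^ k \<in> B} \<in> sets_of p}"
  using assms by (auto simp: sets_of_def upower_def eventually_filtermap betaN_def eventually_conj_iff)

definition basic :: "nat filter set" where
  "basic = {upower p k | p k. p \<in> closure_beta Primes \<and> k \<in> Npos}"

text \<open>Functions from \<^term>\<open>basic\<close> to the naturals are extended by 0 to all filters.\<close>

definition alphas :: "(nat filter \<Rightarrow> nat) set" where
  "alphas = {\<alpha>. finite {b. \<alpha> b \<noteq> 0} \<and> {b. \<alpha> b \<noteq> 0} \<subseteq> basic}"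

text \<open>The pairs \<open>(p, k)\<close> with \<open>p\<^sup>k\<close> in the support of \<open>\<alpha>\<close>: the canonical listing of \<open>\<alpha>\<close>, in which
  only terms with positive multiplicity occur.  Since \<open>p\<^sup>k\<close> determines \<open>p\<close> and \<open>k\<close>
  (\<open>upower_inject\<close>), distinct pairs are distinct basic ultrafilters and the set is finite.\<close>

definition terms_of :: "(nat filter \<Rightarrow> nat) \<Rightarrow> (nat filter \<times> nat) set" where
  "terms_of \<alpha> = {(p, k). p \<in> closure_beta Primes \<and> k \<in> Npos \<and> \<alpha> (upower p k) \<noteq> 0}"

lemma upower_inject:
  assumes p: "p \<in> closure_beta Primes" and q: "q \<in> closure_beta Primes"
    and k: "k \<in> Npos" and l: "l \<in> Npos" and eq: "upower p k = upower q l"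
  shows "p = q \<and> k = l"
proof -
  have evp: "eventually prime p" and evq: "eventually prime q" and nb: "q \<noteq> bot"
    using p q by (auto simp: closure_beta_def sets_of_def Primes_def betaN_def ultrafilter_def)
  have ev: "eventually Q (upower p k) \<longleftrightarrow> eventually Q (upower q l)" for Q
    by (simp add: eq)
  have "eventually (\<lambda>m. \<exists>a. prime a \<and> m = a ^ k) (upower p k)"
    unfolding upower_def eventually_filtermap using evp by (rule eventually_mono) auto
  then have "eventually (\<lambda>b. \<exists>a. prime a \<and> b ^ l = a ^ k) q"
    unfolding ev by (simp add: upower_def eventually_filtermap)
  with evq have "eventually (\<lambda>b. prime b \<and> (\<exists>a. prime a \<and> b ^ l = a ^ k)) q"
    by (rule eventually_conj)
  then obtain a b :: nat where ab: "prime b" "prime a" "b ^ l = a ^ k"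
    using nb by (blast dest: eventually_happens)
  have kl: "k = l"
  proof -
    have "b dvd a ^ k" using ab l by (metis Npos_def atLeast_iff dvd_power not_one_le_zero not_gr_zero)
    then have "b = a" using ab by (metis prime_dvd_power primes_dvd_imp_eq)
    then show ?thesis using ab by (metis power_inject_exp prime_gt_1_nat)
  qed
  have "eventually Q p \<longleftrightarrow> eventually Q q" for Q
  proof -
    have *: "eventually Q r \<longleftrightarrow> eventually (\<lambda>m. \<exists>a. m = a ^ k \<and> Q a) (upower r k)" for r
    proof -
      have "k > 0" using k by (simp add: Npos_def)
      then have "(\<exists>c. a ^ k = c ^ k \<and> Q c) \<longleftrightarrow> Q a" for a
        by (metis power_eq_iff_eq_base zero_le)
      then show ?thesis by (simp add: upower_def eventually_filtermap)
    qed
    show ?thesis using *[of p] *[of q] eq kl by simp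
  qed
  then show ?thesis using kl by (simp add: filter_eq_iff)
qed

lemma finite_terms_of:
  assumes "\<alpha> \<in> alphas"
  shows "finite (terms_of \<alpha>)"
proof (rule inj_on_finite)
  show "inj_on (\<lambda>(p, k). upower p k) (terms_of \<alpha>)"
    by (auto simp: inj_on_def terms_of_def dest: upower_inject)
  show "(\<lambda>(p, k). upower p k) ` terms_of \<alpha> \<subseteq> {b. \<alpha> b \<noteq> 0}"
    by (auto simp: terms_of_def)
  show "finite {b. \<alpha> b \<noteq> 0}"
    using assms by (simp add: alphas_def)
qed

definition \<sigma> :: "(nat filter \<Rightarrow> nat) \<Rightarrow> nat" where
  "\<sigma> \<alpha> = (\<Sum>(p, k)\<in>terms_of \<alpha>. k * \<alpha> (upower p k))"

text \<open>\<open>A t\<close> is the set attached to the term \<open>t = (p, k)\<close>, and \<open>a t j\<close> is the \<open>j\<close>-th of the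
  \<open>\<alpha> (p\<^sup>k)\<close> elements chosen from it; the elements are distinct across all terms.\<close>

definition prod_set ::
  "(nat filter \<Rightarrow> nat) \<Rightarrow> (nat filter \<times> nat \<Rightarrow> nat set) \<Rightarrow> nat set" where
  "prod_set \<alpha> A =
     {\<Prod>(p, k)\<in>terms_of \<alpha>. \<Prod>j=1..\<alpha> (upower p k). a (p, k) j ^ k | a.
        (\<forall>(p, k)\<in>terms_of \<alpha>. \<forall>j\<in>{1..\<alpha> (upower p k)}. a (p, k) j \<in> A (p, k)) \<and>
        inj_on (\<lambda>(t, j). a t j) (SIGMA (p, k):terms_of \<alpha>. {1..\<alpha> (upower p k)})}"

definition F :: "(nat filter \<Rightarrow> nat) \<Rightarrow> nat set set" where
  "F \<alpha> = {prod_set \<alpha> A | A.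
     (\<forall>(p, k)\<in>terms_of \<alpha>. A (p, k) \<in> restrict_Primes p) \<and>
     (\<forall>(p, k)\<in>terms_of \<alpha>. \<forall>(q, l)\<in>terms_of \<alpha>.
        if p = q then A (p, k) = A (q, l) else A (p, k) \<inter> A (q, l) = {})}"

end

theory Submission
  imports Defs "HOL-Library.Disjoint_Sets"
begin

text \<open>
  For almost all elements \<open>m\<close> of \<open>x\<close> the list of exponents in the prime factorization
  \<open>m = q\<^sub>0\<^bsup>e\<^sub>0\<^esup> \<cdots> q\<^bsub>r-1\<^esub>\<^bsup>e\<^bsub>r-1\<^esub>\<^esup>\<close>, with \<open>q\<^sub>0 < \<cdots> < q\<^bsub>r-1\<^esub>\<close>, is the same, because only
  finitely many lists are possible for members of \<open>L n\<close>.  The \<open>i\<close>-th prime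
  factor, as a function of \<open>m\<close>, pushes \<open>x\<close> forward to an ultrafilter \<open>p\<^sub>i\<close> on the primes, and \<open>\<alpha>\<close>
  counts how often each \<open>p\<^sub>i\<^bsup>e\<^sub>i\<^esup>\<close> occurs.  Conversely, finitely many distinct ultrafilters have
  pairwise disjoint members, so \<open>F \<alpha>\<close> is nonempty, and each of its members is contained in
  \<open>L (\<sigma> \<alpha>)\<close>.  As the sets \<open>L n\<close> are pairwise disjoint, this also shows that \<open>\<sigma> \<alpha> = n\<close>
  holds for the function \<open>\<alpha>\<close> constructed in the first part.
\<close>

section \<open>Products of primes and the size of the factorization\<close>

text \<open>Factorizations add up under multiplication, and conversely any listing of the multiset
  of prime factors supplies the \<open>a i\<close>. In this form it is evident that the sets
  \<open>L n\<close> are pairwise disjoint and that indices add when elements are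
  multiplied.\<close>

lemma L_eq_size_prime_factorization:
  "L n = {m. m \<noteq> 0 \<and> size (prime_factorization m) = n}"
proof (intro equalityI subsetI)
  fix m assume "m \<in> L n"
  then obtain a where m: "m = (\<Prod>i=1..n. a i)" and a: "\<forall>i\<in>{1..n}. prime (a i)"
    by (auto simp: L_def Primes_def)
  have nz: "0 \<notin> a ` {1..n}"
    using a by (metis imageE not_prime_0)
  have "prime_factorization m = (\<Sum>i=1..n. prime_factorization (a i))"
    unfolding m using nz by (intro prime_factorization_prod) auto
  also have "\<dots> = (\<Sum>i=1..n. {#a i#})"
    using a by (intro sum.cong) (auto simp: prime_factorization_prime)
  finally have "size (prime_factorization m) = n"
    by (simp add: size_multiset_sum)
  then show "m \<in> {m. m \<noteq> 0 \<and> size (prime_factorization m) = n}"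
    using nz by (auto simp: m)
next
  fix m :: nat assume "m \<in> {m. m \<noteq> 0 \<and> size (prime_factorization m) = n}"
  then have m: "m \<noteq> 0" "size (prime_factorization m) = n" by auto
  obtain xs where xs: "mset xs = prime_factorization m"
    using ex_mset by blast
  have len: "length xs = n"
    using m xs by (metis size_mset)
  have "m = prod_mset (mset xs)"
    using m by (simp add: xs prod_mset_prime_factorization_nat)
  also have "\<dots> = (\<Prod>i<n. xs ! i)"
    by (simp add: prod_mset_prod_list prod.list_conv_set_nth len atLeast0LessThan)
  also have "\<dots> = (\<Prod>i=1..n. xs ! (i - 1))"
    by (rule prod.reindex_bij_witness[of _ "\<lambda>i. i - 1" Suc]) auto
  finally have "m = (\<Prod>i=1..n. xs ! (i - 1))" .
  moreover have "xs ! (i - 1) \<in> Primes" if "i \<in> {1..n}" for i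
  proof -
    have "xs ! (i - 1) \<in># mset xs"
      using that len by auto
    then show ?thesis
      by (auto simp: xs Primes_def)
  qed
  ultimately show "m \<in> L n"
    unfolding L_def by blast
qed

lemma L_subset_Npos: "L n \<subseteq> Npos"
  by (auto simp: L_eq_size_prime_factorization Npos_def)

lemma prod_in_L:
  assumes "finite S" and "\<And>s. s \<in> S \<Longrightarrow> f s \<in> L (g s)"
  shows "prod f S \<in> L (sum g S)"
  using assms
  by (induction S rule: finite_induct)
     (auto simp: L_eq_size_prime_factorization prime_factorization_mult)

lemma prime_power_in_L: "prime p \<Longrightarrow> p ^ k \<in> L k"
  by (auto simp: L_eq_size_prime_factorization prime_factorization_prime_power prime_gt_0_nat)

text \<open>Each factor \<open>a (p, k) j ^ k\<close> lies in \<open>L k\<close>, so the term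
  \<open>(p, k)\<close> contributes \<open>k * \<alpha> (upower p k)\<close> to the index; these
  contributions sum to \<open>\<sigma> \<alpha>\<close>.\<close>

lemma prod_set_subset_L:
  assumes "\<alpha> \<in> alphas" and "\<And>p k. (p, k) \<in> terms_of \<alpha> \<Longrightarrow> A (p, k) \<subseteq> Primes"
  shows "prod_set \<alpha> A \<subseteq> L (\<sigma> \<alpha>)"
proof
  fix m assume "m \<in> prod_set \<alpha> A"
  then obtain a where
    m: "m = (\<Prod>(p, k)\<in>terms_of \<alpha>. \<Prod>j=1..\<alpha> (upower p k). a (p, k) j ^ k)"
    and a: "\<forall>(p, k)\<in>terms_of \<alpha>. \<forall>j\<in>{1..\<alpha> (upower p k)}. a (p, k) j \<in> A (p, k)"
    by (auto simp: prod_set_def)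
  show "m \<in> L (\<sigma> \<alpha>)"
    unfolding m \<sigma>_def
  proof (rule prod_in_L[OF finite_terms_of[OF assms(1)]], clarify)
    fix p k assume t: "(p, k) \<in> terms_of \<alpha>"
    have "(\<Prod>j=1..\<alpha> (upower p k). a (p, k) j ^ k) \<in> L (\<Sum>j=1..\<alpha> (upower p k). k)"
    proof (intro prod_in_L prime_power_in_L)
      fix j assume "j \<in> {1..\<alpha> (upower p k)}"
      then have "a (p, k) j \<in> A (p, k)"
        using a t by fastforce
      then show "prime (a (p, k) j)"
        using assms(2)[OF t] by (auto simp: Primes_def)
    qed simp
    then show "(\<Prod>j=1..\<alpha> (upower p k). a (p, k) j ^ k) \<in> L (k * \<alpha> (upower p k))"
      by (simp add: mult.commute)
  qed
qed

section \<open>Separation, finite-valued maps and images of ultrafilters\<close>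

lemma ultrafilter_separate:
  assumes "ultrafilter p" "ultrafilter q" "p \<noteq> q"
  shows "\<exists>Q. eventually Q p \<and> eventually (\<lambda>a. \<not> Q a) q"
proof -
  obtain Q where "eventually Q p \<noteq> eventually Q q"
    using assms(3) by (auto simp: filter_eq_iff)
  then consider "eventually Q p" "\<not> eventually Q q" | "\<not> eventually Q p" "eventually Q q"
    by blast
  then show ?thesis
  proof cases
    case 1
    then show ?thesis using assms(2) unfolding ultrafilter_def by blast
  next
    case 2
    then have "eventually (\<lambda>a. \<not> Q a) p" using assms(1) unfolding ultrafilter_def by blast
    with 2 show ?thesis by (intro exI[of _ "\<lambda>a. \<not> Q a"]) simp
  qed
qed

lemma finite_ultrafilters_disjoint_members:
  assumes "finite T" and "\<And>p. p \<in> T \<Longrightarrow> ultrafilter p"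
  shows "\<exists>B. (\<forall>p\<in>T. eventually (\<lambda>a. a \<in> B p) p) \<and> disjoint_family_on B T"
proof -
  obtain S where S: "eventually (S p q) p \<and> eventually (\<lambda>a. \<not> S p q a) q"
    if "p \<in> T" "q \<in> T" "p \<noteq> q" for p q
    using assms(2) ultrafilter_separate by metis
  \<comment> \<open>Imposing both \<open>S p q\<close> and the negation of \<open>S q p\<close>
    makes the definition antisymmetric in \<open>p\<close> and \<open>q\<close>, which forces
    disjointness. Finiteness of \<open>T\<close> keeps the intersection in \<open>p\<close>.\<close>
  define B where "B p = {a. \<forall>q\<in>T - {p}. S p q a \<and> \<not> S q p a}" for p
  have "eventually (\<lambda>a. a \<in> B p) p" if "p \<in> T" for p
    unfolding B_def mem_Collect_eq using S that assms(1)
    by (intro eventually_ball_finite) (auto intro!: eventually_conj)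
  moreover have "disjoint_family_on B T"
    unfolding disjoint_family_on_def B_def by blast
  ultimately show ?thesis by blast
qed

text \<open>If no fibre over \<open>S\<close> belonged to \<open>x\<close>, the finitely many
  complements would, and together with the preimage of \<open>S\<close> they have empty
  intersection.\<close>

lemma ultrafilter_finite_range:
  assumes "ultrafilter x" and "finite S" and "eventually (\<lambda>a. f a \<in> S) x"
  shows "\<exists>s\<in>S. eventually (\<lambda>a. f a = s) x"
proof (rule ccontr)
  assume "\<not> ?thesis"
  then have "\<forall>s\<in>S. eventually (\<lambda>a. f a \<noteq> s) x"
    using assms(1) unfolding ultrafilter_def by blast
  with assms(2) have "eventually (\<lambda>a. \<forall>s\<in>S. f a \<noteq> s) x"
    by (simp add: eventually_ball_finite)
  with assms(3) have "eventually (\<lambda>a. False) x"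
    by eventually_elim auto
  with assms(1) show False
    by (simp add: ultrafilter_def trivial_limit_def)
qed

lemma ultrafilter_filtermap: "ultrafilter x \<Longrightarrow> ultrafilter (filtermap f x)"
  by (auto simp: ultrafilter_def eventually_filtermap filtermap_bot_iff)

lemma closure_beta_Primes_iff:
  "p \<in> closure_beta Primes \<longleftrightarrow> ultrafilter p \<and> eventually prime p"
proof -
  have "eventually (\<lambda>a. a \<in> Npos) p" if "eventually prime p"
    using that by (rule eventually_mono) (auto simp: Npos_def dest: prime_ge_1_nat)
  then show ?thesis
    by (auto simp: closure_beta_def betaN_def sets_of_def Primes_def Npos_def dest: prime_ge_1_nat)
qed

text \<open>As \<open>Primes\<close> belongs to \<open>p\<close>, intersecting a member of
  \<open>p\<close> with it gives a member again.\<close>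

lemma restrict_Primes_iff:
  assumes "p \<in> closure_beta Primes"
  shows "X \<in> restrict_Primes p \<longleftrightarrow> X \<subseteq> Primes \<and> eventually (\<lambda>a. a \<in> X) p"
proof
  assume "X \<in> restrict_Primes p"
  then show "X \<subseteq> Primes \<and> eventually (\<lambda>a. a \<in> X) p"
    using assms
    by (auto simp: restrict_Primes_def sets_of_def closure_beta_def eventually_conj_iff)
next
  assume X: "X \<subseteq> Primes \<and> eventually (\<lambda>a. a \<in> X) p"
  then have "X \<in> sets_of p" "X = X \<inter> Primes"
    using assms by (auto simp: sets_of_def closure_beta_def)
  then show "X \<in> restrict_Primes p"
    unfolding restrict_Primes_def by blast
qed

section \<open>From \<open>F \<alpha>\<close> to \<open>L (\<sigma> \<alpha>)\<close>\<close>

text \<open>One member of \<open>F \<alpha>\<close> suffices, since it lies in \<open>x\<close> and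
  is contained in \<open>L (\<sigma> \<alpha>)\<close>. The work is to exhibit one.\<close>

lemma L_\<sigma>_in_sets_of:
  assumes \<alpha>: "\<alpha> \<in> alphas" and sub: "F \<alpha> \<subseteq> sets_of x"
  shows "L (\<sigma> \<alpha>) \<in> sets_of x"
proof -
  have terms: "p \<in> closure_beta Primes" if "(p, k) \<in> terms_of \<alpha>" for p k
    using that by (auto simp: terms_of_def)
  obtain B where B: "\<forall>p\<in>fst ` terms_of \<alpha>. eventually (\<lambda>a. a \<in> B p) p"
    and disj: "disjoint_family_on B (fst ` terms_of \<alpha>)"
    using finite_ultrafilters_disjoint_members[of "fst ` terms_of \<alpha>"] finite_terms_of[OF \<alpha>] terms
    by (force simp: closure_beta_Primes_iff)
  \<comment> \<open>Letting \<open>A\<close> depend on \<open>fst t\<close> alone gives terms with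
    the same ultrafilter the same set, as condition (ii) demands.\<close>
  define A where "A t = B (fst t) \<inter> Primes" for t :: "nat filter \<times> nat"
  have "A (p, k) \<in> restrict_Primes p" if t: "(p, k) \<in> terms_of \<alpha>" for p k
  proof -
    have "eventually (\<lambda>a. a \<in> B p) p"
      using B t by force
    then show ?thesis
      using terms[OF t] unfolding restrict_Primes_iff[OF terms[OF t]] closure_beta_Primes_iff
      by (auto simp: A_def Primes_def eventually_conj_iff)
  qed
  moreover have "A (p, k) \<inter> A (q, l) = {}"
    if "(p, k) \<in> terms_of \<alpha>" "(q, l) \<in> terms_of \<alpha>" "p \<noteq> q" for p q k l
    using disjoint_family_onD[OF disj, of p q] that by (force simp: A_def)
  ultimately have "prod_set \<alpha> A \<in> F \<alpha>"
    unfolding F_def by (intro CollectI exI[of _ A]) (fastforce simp: A_def)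
  with sub have "eventually (\<lambda>a. a \<in> prod_set \<alpha> A) x"
    by (auto simp: sets_of_def)
  moreover have "prod_set \<alpha> A \<subseteq> L (\<sigma> \<alpha>)"
    using \<alpha> by (rule prod_set_subset_L) (simp add: A_def)
  ultimately have "eventually (\<lambda>a. a \<in> L (\<sigma> \<alpha>)) x"
    by (auto elim: eventually_mono)
  then show ?thesis
    using L_subset_Npos by (simp add: sets_of_def)
qed

section \<open>Sorted prime factors and their exponents\<close>

text \<open>Sorting makes the prime at position \<open>i\<close> a function of \<open>m\<close>,
  along which an ultrafilter can be pushed forward.\<close>

definition prime_list :: "nat \<Rightarrow> nat list" where
  "prime_list m = sorted_list_of_set (prime_factors m)"

definition exponent_list :: "nat \<Rightarrow> nat list" where
  "exponent_list m = map (\<lambda>q. multiplicity q m) (prime_list m)"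

lemma set_prime_list [simp]: "set (prime_list m) = prime_factors m"
  and distinct_prime_list [simp]: "distinct (prime_list m)"
  by (simp_all add: prime_list_def)

lemma length_exponent_list [simp]: "length (exponent_list m) = length (prime_list m)"
  by (simp add: exponent_list_def)

lemma exponent_list_pos: "e \<in> set (exponent_list m) \<Longrightarrow> e > 0"
  by (auto simp: exponent_list_def prime_factors_multiplicity)

lemma prod_prime_list_power:
  assumes "m \<noteq> 0"
  shows "m = (\<Prod>i<length (prime_list m). prime_list m ! i ^ (exponent_list m ! i))"
proof -
  have "m = (\<Prod>q\<in>prime_factors m. q ^ multiplicity q m)"
    using assms by (intro prime_factorization_nat) auto
  also have "\<dots> = prod_list (map (\<lambda>q. q ^ multiplicity q m) (prime_list m))"
    by (simp add: prod.distinct_set_conv_list flip: set_prime_list)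
  also have "\<dots> = (\<Prod>i<length (prime_list m). prime_list m ! i ^ (exponent_list m ! i))"
    by (simp add: prod.list_conv_set_nth exponent_list_def atLeast0LessThan)
  finally show ?thesis .
qed

text \<open>The exponents are positive and sum to \<open>n\<close>, so there are at most
  \<open>n\<close> of them, each at most \<open>n\<close>.\<close>

lemma finite_exponent_list_L: "finite (exponent_list ` L n)"
proof (rule finite_subset)
  show "exponent_list ` L n \<subseteq> {es. set es \<subseteq> {..n} \<and> length es \<le> n}"
  proof (clarify, intro conjI subsetI)
    fix m assume "m \<in> L n"
    then have m: "size (prime_factorization m) = n"
      by (simp add: L_eq_size_prime_factorization)
    have "card (prime_factors m) \<le> n"
      unfolding m[symmetric] size_multiset_overloaded_eq
      using sum_mono[of "prime_factors m" "\<lambda>_. 1" "count (prime_factorization m)"]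
      by (simp add: Suc_le_eq)
    then show "length (exponent_list m) \<le> n"
      by (simp add: prime_list_def)
    fix e assume "e \<in> set (exponent_list m)"
    then obtain q where "q \<in> prime_factors m" "e = multiplicity q m"
      by (auto simp: exponent_list_def)
    then have "e = count (prime_factorization m) q"
      by (simp add: count_prime_factorization_prime in_prime_factors_imp_prime)
    then show "e \<in> {..n}"
      using m count_le_size by fastforce
  qed
  show "finite {es :: nat list. set es \<subseteq> {..n} \<and> length es \<le> n}"
    by (rule finite_lists_length_le) simp
qed

section \<open>Construction of \<open>\<alpha>\<close> from \<open>x\<close>\<close>

lemma exists_alpha:
  assumes x: "x \<in> closure_beta (L n)"
  shows "\<exists>\<alpha>\<in>alphas. F \<alpha> \<subseteq> sets_of x"
proof -
  have ux: "ultrafilter x" and Npos: "eventually (\<lambda>m. m \<in> Npos) x"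
    and Ln: "eventually (\<lambda>m. m \<in> L n) x"
    using x by (auto simp: closure_beta_def betaN_def sets_of_def)
  have "eventually (\<lambda>m. exponent_list m \<in> exponent_list ` L n) x"
    using Ln by (rule eventually_mono) auto
  then obtain es where es: "eventually (\<lambda>m. exponent_list m = es) x"
    using ultrafilter_finite_range[OF ux finite_exponent_list_L] by blast
  define r where "r = length es"
  \<comment> \<open>For \<open>i < r\<close> the position \<open>i\<close> exists in
    \<open>prime_list m\<close> for almost all \<open>m\<close>, so values of \<open>!\<close>
    beyond the end of the list do not matter. Different positions may yield the same
    ultrafilter.\<close>
  define P where "P i = filtermap (\<lambda>m. prime_list m ! i) x" for i
  have es_pos: "es ! i \<in> Npos" if "i < r" for i
  proof -
    obtain m where "exponent_list m = es"
      using es ux eventually_happens' unfolding ultrafilter_def by blast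
    then show ?thesis
      using that exponent_list_pos[of "es ! i" m] by (auto simp: r_def Npos_def)
  qed
  have P: "P i \<in> closure_beta Primes" if "i < r" for i
    unfolding closure_beta_Primes_iff
  proof
    show "ultrafilter (P i)"
      unfolding P_def using ux by (rule ultrafilter_filtermap)
    show "eventually prime (P i)"
      unfolding P_def eventually_filtermap using es
    proof eventually_elim
      case (elim m)
      then have "prime_list m ! i \<in> set (prime_list m)"
        using that by (metis length_exponent_list nth_mem r_def)
      then show ?case by auto
    qed
  qed
  define I where "I t = {i \<in> {..<r}. (P i, es ! i) = t}" for t
  \<comment> \<open>Counting positions by the filter \<open>upower (P i) (es ! i)\<close> makes the
    support finite and basic; \<open>upower_inject\<close> identifies the values with the sizes of
    the fibres \<open>I t\<close>.\<close>
  define \<alpha> where "\<alpha> b = card {i \<in> {..<r}. upower (P i) (es ! i) = b}" for b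
  have \<alpha>_eq: "\<alpha> (upower p k) = card (I (p, k))" if "p \<in> closure_beta Primes" "k \<in> Npos" for p k
    unfolding \<alpha>_def I_def using that P es_pos
    by (intro arg_cong[where f = card]) (auto dest: upower_inject)
  have supp: "{b. \<alpha> b \<noteq> 0} \<subseteq> (\<lambda>i. upower (P i) (es ! i)) ` {..<r}"
    by (auto simp: \<alpha>_def card_eq_0_iff)
  have \<alpha>: "\<alpha> \<in> alphas"
  proof -
    have "finite {b. \<alpha> b \<noteq> 0}"
      using supp by (rule finite_subset) simp
    moreover have "{b. \<alpha> b \<noteq> 0} \<subseteq> basic"
      using supp P es_pos unfolding basic_def by fast
    ultimately show ?thesis
      by (simp add: alphas_def)
  qed
  have terms: "terms_of \<alpha> = (\<lambda>i. (P i, es ! i)) ` {..<r}"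
  proof (intro equalityI subsetI)
    fix t assume "t \<in> terms_of \<alpha>"
    then have "card (I t) \<noteq> 0"
      by (auto simp: terms_of_def \<alpha>_eq)
    then have "I t \<noteq> {}" by auto
    then show "t \<in> (\<lambda>i. (P i, es ! i)) ` {..<r}"
      by (auto simp: I_def)
  next
    fix t assume "t \<in> (\<lambda>i. (P i, es ! i)) ` {..<r}"
    then obtain i where i: "i < r" "t = (P i, es ! i)" by auto
    then have "i \<in> I t" by (simp add: I_def)
    moreover have "finite (I t)" by (simp add: I_def)
    ultimately have "card (I t) \<noteq> 0" by auto
    then show "t \<in> terms_of \<alpha>"
      using i P es_pos by (simp add: terms_of_def \<alpha>_eq)
  qed
  have \<alpha>_terms: "\<alpha> (upower p k) = card (I (p, k))" if "(p, k) \<in> terms_of \<alpha>" for p k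
    using that by (intro \<alpha>_eq) (auto simp: terms_of_def)
  have "\<exists>h. bij_betw h {1..card (I t)} (I t)" for t
    by (rule ex_bij_betw_nat_finite_1) (simp add: I_def)
  \<comment> \<open>\<open>g t\<close> numbers the positions in \<open>I t\<close> from 1, matching
    the index range in \<open>prod_set\<close>.\<close>
  then obtain g where g: "bij_betw (g t) {1..card (I t)} (I t)" for t
    by metis
  have "prod_set \<alpha> A \<in> sets_of x"
    if A: "\<forall>(p, k)\<in>terms_of \<alpha>. A (p, k) \<in> restrict_Primes p" for A
  proof -
    have AP: "A (P i, es ! i) \<subseteq> Primes" and
      AE: "eventually (\<lambda>a. a \<in> A (P i, es ! i)) (P i)" if "i < r" for i
      using that A restrict_Primes_iff[OF P[OF that]] by (auto simp: terms)
    have "eventually (\<lambda>m. \<forall>i\<in>{..<r}. prime_list m ! i \<in> A (P i, es ! i)) x"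
      using AE by (intro eventually_ball_finite) (auto simp: P_def eventually_filtermap)
    with Npos es have "eventually (\<lambda>m. m \<in> prod_set \<alpha> A) x"
    proof eventually_elim
      case (elim m)
      have len: "length (prime_list m) = r"
        using elim(2) by (metis length_exponent_list r_def)
      \<comment> \<open>The witnesses for membership in \<open>prod_set \<alpha> A\<close> are the
        prime factors of \<open>m\<close> itself, sorted by term.\<close>
      define a where "a t j = prime_list m ! g t j" for t j
      have gI: "g t j \<in> I t" if "j \<in> {1..card (I t)}" for t j
        using g[of t] that by (auto simp: bij_betw_def)
      have "m = (\<Prod>i<r. prime_list m ! i ^ (es ! i))"
        using prod_prime_list_power[of m] elim(1,2) len by (simp add: Npos_def)
      \<comment> \<open>The fibres \<open>I t\<close> partition the positions, and on
        \<open>I t\<close> the exponent is constantly \<open>snd t\<close>.\<close>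
      also have "\<dots> = (\<Prod>t\<in>terms_of \<alpha>. \<Prod>i\<in>I t. prime_list m ! i ^ (es ! i))"
        unfolding I_def by (rule prod.group[symmetric]) (auto simp: terms)
      also have "\<dots> = (\<Prod>t\<in>terms_of \<alpha>. \<Prod>i\<in>I t. prime_list m ! i ^ snd t)"
        by (intro prod.cong) (auto simp: I_def)
      also have "\<dots> = (\<Prod>t\<in>terms_of \<alpha>. \<Prod>j=1..card (I t). a t j ^ snd t)"
        unfolding a_def by (intro prod.cong refl prod.reindex_bij_betw[OF g, symmetric])
      also have "\<dots> = (\<Prod>(p, k)\<in>terms_of \<alpha>. \<Prod>j=1..\<alpha> (upower p k). a (p, k) j ^ k)"
        by (intro prod.cong) (auto simp: \<alpha>_terms)
      finally have m: "m = \<dots>" .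
      have "a (p, k) j \<in> A (p, k)"
        if "(p, k) \<in> terms_of \<alpha>" "j \<in> {1..\<alpha> (upower p k)}" for p k j
        using gI[of j "(p, k)"] that elim(3) by (force simp: I_def a_def \<alpha>_terms)
      moreover have "inj_on (\<lambda>(t, j). a t j) (SIGMA (p, k):terms_of \<alpha>. {1..\<alpha> (upower p k)})"
      proof (rule inj_onI, unfold split_paired_all, unfold mem_Sigma_iff prod.case, elim conjE)
        fix p k j q l i
        assume t: "(p, k) \<in> terms_of \<alpha>" "j \<in> {1..\<alpha> (upower p k)}"
          and s: "(q, l) \<in> terms_of \<alpha>" "i \<in> {1..\<alpha> (upower q l)}"
          and eq: "a (p, k) j = a (q, l) i"
        have j: "j \<in> {1..card (I (p, k))}" and i: "i \<in> {1..card (I (q, l))}"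
          using t s by (auto simp: \<alpha>_terms)
        have "g (p, k) j < r" "g (q, l) i < r"
          using gI[OF j] gI[OF i] by (auto simp: I_def)
        \<comment> \<open>The entries of \<open>prime_list m\<close> are distinct, so equal primes
          sit at equal positions. A position lies in only one fibre, and within it \<open>g\<close>
          is injective.\<close>
        then have g_eq: "g (p, k) j = g (q, l) i"
          using eq len by (simp add: a_def nth_eq_iff_index_eq)
        then have pk: "(p, k) = (q, l)"
          using gI[OF j] gI[OF i] by (auto simp: I_def)
        then show "((p, k), j) = ((q, l), i)"
          using g_eq g[of "(p, k)"] i j by (auto simp: bij_betw_def dest: inj_onD)
      qed
      ultimately show ?case
        unfolding prod_set_def using m by blast
    qed
    moreover have "prod_set \<alpha> A \<subseteq> Npos"
    proof -
      have "prod_set \<alpha> A \<subseteq> L (\<sigma> \<alpha>)"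
        using \<alpha> AP by (intro prod_set_subset_L) (auto simp: terms)
      then show ?thesis using L_subset_Npos by blast
    qed
    ultimately show ?thesis
      by (simp add: sets_of_def)
  qed
  then have "F \<alpha> \<subseteq> sets_of x"
    unfolding F_def by blast
  with \<alpha> show ?thesis by blast
qed

theorem theorem5p5:
  fixes n :: nat and x :: "nat filter"
  assumes "n \<in> Npos" and "x \<in> betaN"
  shows "x \<in> closure_beta (L n) \<longleftrightarrow>
    (\<exists>\<alpha>\<in>alphas. \<sigma> \<alpha> = n \<and> F \<alpha> \<subseteq> sets_of x)"
proof
  assume x: "x \<in> closure_beta (L n)"
  then obtain \<alpha> where \<alpha>: "\<alpha> \<in> alphas" "F \<alpha> \<subseteq> sets_of x"
    using exists_alpha by blast
  have "eventually (\<lambda>m. m \<in> L (\<sigma> \<alpha>)) x" "eventually (\<lambda>m. m \<in> L n) x"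
    using L_\<sigma>_in_sets_of[OF \<alpha>] x by (auto simp: sets_of_def closure_beta_def)
  then have "eventually (\<lambda>m. m \<in> L (\<sigma> \<alpha>) \<and> m \<in> L n) x"
    by (rule eventually_conj)
  then obtain m where "m \<in> L (\<sigma> \<alpha>)" "m \<in> L n"
    using assms(2) eventually_happens' unfolding betaN_def ultrafilter_def by blast
  then have "\<sigma> \<alpha> = n"
    by (simp add: L_eq_size_prime_factorization)
  with \<alpha> show "\<exists>\<alpha>\<in>alphas. \<sigma> \<alpha> = n \<and> F \<alpha> \<subseteq> sets_of x"
    by blast
next
  assume "\<exists>\<alpha>\<in>alphas. \<sigma> \<alpha> = n \<and> F \<alpha> \<subseteq> sets_of x"
  then show "x \<in> closure_beta (L n)"
    using L_\<sigma>_in_sets_of assms(2) by (auto simp: closure_beta_def)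
qed

end
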